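(* Let $\zeta:\{0,1\}\to\{0,1\}^*$ be a primitive aperiodic binary substitution of constant length $q\ge 2$ such that $\zeta(0)$ starts with $0$, and let $x=\zeta^\infty(0)$. Let $n\ge2$. Then, in the recurrence plot $\mathcal{R}(x,\infty,1/2)$, the number of different lengths of $0$-boundary lines starting in $[0,n)^2$ is bounded from above by $$(\varrho-1)(1+\log_q n),$$ and the length of every such line is less than $\varrho n$.
   Context: $\mathbb{N}$ = positive integers, $\mathbb{N}_0=\mathbb{N}\cup\{0\}$, $A=\{0,1\}$, $[0,n)=\{0,\dots,n-1\}$; $y_{[i,j)}=y_i\dots y_{j-1}$ for a sequence $y$. A substitution of constant length $q\ge2$ is a map $\zeta:A\to A^*$ with $|\zeta(0)|=|\zeta(1)|=q$, extended to words and sequences by concatenation. It is primitive if there is $k\ge1$ such that for all $a,b\in A$ the letter $b$ occurs in $\zeta^k(a)$. $\mathcal{L}_\zeta$ is the set of all subwords of the words $\zeta^k(a)$ ($k\ge0$, $a\in A$). $X_\zeta=\{y\in A^{\mathbb{N}_0}: y_{[0,n)}\in\mathcal{L}_\zeta\ \forall n\ge1\}$. $\zeta$ is aperiodic if $X_\zeta$ contains a sequence that is not periodic under the shift (i.e. not of the form $u^\infty$). $x=\zeta^\infty(0)=\lim_k\zeta^k(0)$ is the unique fixed point of $\zeta$ starting with $0$. $\alpha$ (resp. $\beta$) is the length of the longest common prefix (resp. suffix) of $\zeta(0)$ and $\zeta(1)$. A nonempty word $w\in\mathcal{L}_\zeta$ is recognizable if there is a (unique) integer $p_w\in[0,q)$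 with $\{i\in\mathbb{N}_0: x_{[i,i+|w|)}=w\}\subseteq q\mathbb{N}_0+p_w$. $\varrho\in\mathbb{N}_0$ is the smallest integer such that $\varrho>\alpha+\beta$ and every $w\in\mathcal{L}_\zeta$ of length at least $\varrho$ is recognizable. (Such $\varrho$ exists.) $\mathcal{R}(x,\infty,1/2)$ is the infinite $0$-$1$ matrix $(\mathcal{R}_{ij})_{i,j\in\mathbb{N}_0}$ with $\mathcal{R}_{ij}=1$ iff $x_i=x_j$. A $0$-boundary line of length $\ell\in\mathbb{N}$ is a triple $(i,j,\ell)$ with $i,j\in\mathbb{N}_0$, $i\ne j$, $\min\{i,j\}=0$, $\mathcal{R}_{i+h,j+h}=1$ for $0\le h<\ell$, and $\mathcal{R}_{i+\ell,j+\ell}=0$; it starts in $[0,n)^2$ if its starting point $(i,j)$ lies in $[0,n)^2$. *)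

theory Defs
  imports Complex_Main "HOL-Library.Sublist" "HOL-Library.Z2"
begin

text \<open>
  The alphabet \<open>{0, 1}\<close> is the type \<^typ>\<open>bit\<close>. Words are of type \<^typ>\<open>bit list\<close>, one-sided
  infinite sequences (indexed from \<open>0\<close>) of type \<^typ>\<open>nat \<Rightarrow> bit\<close>.
\<close>

type_synonym substitution = "bit \<Rightarrow> bit list"

definition constant_length :: "substitution \<Rightarrow> nat \<Rightarrow> bool" where
  "constant_length \<zeta> q \<longleftrightarrow> (\<forall>a. length (\<zeta> a) = q)"

definition subst_word :: "substitution \<Rightarrow> bit list \<Rightarrow> bit list" where
  "subst_word \<zeta> w = concat (map \<zeta> w)"

definition subst_iter :: "substitution \<Rightarrow> nat \<Rightarrow> bit \<Rightarrow> bit list" where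
  "subst_iter \<zeta> k a = (subst_word \<zeta> ^^ k) [a]"

definition primitive :: "substitution \<Rightarrow> bool" where
  "primitive \<zeta> \<longleftrightarrow> (\<exists>k\<ge>1. \<forall>a b. b \<in> set (subst_iter \<zeta> k a))"

definition language :: "substitution \<Rightarrow> bit list set" where
  "language \<zeta> = {w. \<exists>k a. sublist w (subst_iter \<zeta> k a)}"

text \<open>\<open>factor y i n\<close> is the word \<open>y\<^sub>i \<dots> y\<^bsub>i+n-1\<^esub>\<close>.\<close>

definition factor :: "(nat \<Rightarrow> bit) \<Rightarrow> nat \<Rightarrow> nat \<Rightarrow> bit list" where
  "factor y i n = map y [i..<i + n]"

definition subst_space :: "substitution \<Rightarrow> (nat \<Rightarrow> bit) set" where
  "subst_space \<zeta> = {y. \<forall>n\<ge>1. factor y 0 n \<in> language \<zeta>}"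

definition shift_periodic :: "(nat \<Rightarrow> bit) \<Rightarrow> bool" where
  "shift_periodic y \<longleftrightarrow> (\<exists>p\<ge>1. \<forall>i. y (i + p) = y i)"

definition aperiodic :: "substitution \<Rightarrow> bool" where
  "aperiodic \<zeta> \<longleftrightarrow> (\<exists>y \<in> subst_space \<zeta>. \<not> shift_periodic y)"

text \<open>
  The limit of the words \<open>\<zeta>\<^sup>k(0)\<close>, that is, every letter of the sequence is eventually the letter of
  \<open>\<zeta>\<^sup>k(0)\<close> at the same position. It exists (and is unique) if \<open>\<zeta>(0)\<close> starts with \<open>0\<close> and \<open>\<zeta>\<close> has
  constant length at least \<open>2\<close>.
\<close>

definition fixed_point :: "substitution \<Rightarrow> nat \<Rightarrow> bit" where
  "fixed_point \<zeta> = (THE x. \<forall>i. \<forall>\<^sub>F k in sequentially.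
     i < length (subst_iter \<zeta> k 0) \<and> subst_iter \<zeta> k 0 ! i = x i)"

definition common_prefix_length :: "substitution \<Rightarrow> nat" where
  "common_prefix_length \<zeta> = length (longest_common_prefix (\<zeta> 0) (\<zeta> 1))"

definition common_suffix_length :: "substitution \<Rightarrow> nat" where
  "common_suffix_length \<zeta> = length (longest_common_prefix (rev (\<zeta> 0)) (rev (\<zeta> 1)))"

definition recognizable :: "substitution \<Rightarrow> nat \<Rightarrow> bit list \<Rightarrow> bool" where
  "recognizable \<zeta> q w \<longleftrightarrow> w \<noteq> [] \<and> w \<in> language \<zeta> \<and>
     (\<exists>!p. p < q \<and> {i. factor (fixed_point \<zeta>) i (length w) = w} \<subseteq> {q * m + p |m. True})"

text \<open>
  The constant \<open>\<rho>\<close> below is meaningful only if some \<open>r\<close> with the stated property exists, which is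
  the case for primitive aperiodic \<open>\<zeta>\<close> of constant length \<open>q \<ge> 2\<close> such that \<open>\<zeta>(0)\<close> starts with \<open>0\<close>.
\<close>

definition recognizability_const :: "substitution \<Rightarrow> nat \<Rightarrow> nat" where
  "recognizability_const \<zeta> q = (LEAST r.
     common_prefix_length \<zeta> + common_suffix_length \<zeta> < r \<and>
     (\<forall>w \<in> language \<zeta>. r \<le> length w \<longrightarrow> recognizable \<zeta> q w))"

text \<open>
  The infinite recurrence plot of \<open>x\<close>; for threshold \<open>1/2\<close> recurrence of the letters means equality.
\<close>

definition recurrence_plot :: "(nat \<Rightarrow> bit) \<Rightarrow> nat \<Rightarrow> nat \<Rightarrow> nat" where
  "recurrence_plot x i j = (if x i = x j then 1 else 0)"

definition zero_boundary_line :: "(nat \<Rightarrow> bit) \<Rightarrow> nat \<Rightarrow> nat \<Rightarrow> nat \<Rightarrow> bool" where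
  "zero_boundary_line x i j l \<longleftrightarrow> l \<ge> 1 \<and> i \<noteq> j \<and> min i j = 0 \<and>
     (\<forall>h<l. recurrence_plot x (i + h) (j + h) = 1) \<and> recurrence_plot x (i + l) (j + l) = 0"

definition zero_boundary_line_lengths :: "(nat \<Rightarrow> bit) \<Rightarrow> nat \<Rightarrow> nat set" where
  "zero_boundary_line_lengths x n = {l. \<exists>i<n. \<exists>j<n. zero_boundary_line x i j l}"

end

theory Submission
  imports Defs
begin

text \<open>
  Let \<open>\<alpha>\<close> be the length of the longest common prefix of \<open>\<zeta>(0)\<close> and \<open>\<zeta>(1)\<close>, and let \<open>l\<close> be the
  length of the longest common prefix of \<open>x\<close> and its \<open>j\<close>-th shift. If \<open>l \<ge> \<rho>\<close>, then recognizability
  forces \<open>j = q j'\<close>, and \<open>l = q l' + \<alpha>\<close> for the length \<open>l'\<close> belonging to \<open>j'\<close>. Hence every length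
  arises from some \<open>l' < \<rho>\<close> by at most \<open>log\<^sub>q j\<close> iterations of \<open>l \<mapsto> q l + \<alpha>\<close>.

  That \<open>\<rho>\<close> is meaningful is the recognizability theorem: if a long word occurred at two positions
  that differ modulo \<open>q\<close>, then over the binary alphabet some long block of \<open>x\<close> would be constant,
  equal to a shift of the block it agrees with, or the complement of such a shift. By uniform
  recurrence each case gives arbitrarily long words of bounded period, against aperiodicity.
\<close>

section \<open>Words and iterates under a substitution of constant length\<close>

lemma length_subst_word:
  assumes "constant_length \<zeta> q"
  shows "length (subst_word \<zeta> w) = q * length w"
  using assms by (induction w) (auto simp: subst_word_def constant_length_def)

lemma subst_word_append: "subst_word \<zeta> (u @ v) = subst_word \<zeta> u @ subst_word \<zeta> v"
  by (simp add: subst_word_def)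

lemma nth_subst_word:
  assumes "constant_length \<zeta> q" and "m < length w" and "r < q"
  shows "subst_word \<zeta> w ! (q * m + r) = \<zeta> (w ! m) ! r"
  using assms(2)
proof (induction w arbitrary: m)
  case (Cons a w)
  have len: "length (\<zeta> a) = q"
    using assms(1) by (simp add: constant_length_def)
  show ?case
  proof (cases m)
    case 0
    then show ?thesis
      using assms(3) len by (simp add: subst_word_def nth_append)
  next
    case (Suc m')
    then show ?thesis
      using Cons len by (simp add: subst_word_def nth_append)
  qed
qed simp

lemma subst_iter_0: "subst_iter \<zeta> 0 a = [a]"
  by (simp add: subst_iter_def)

lemma subst_iter_Suc: "subst_iter \<zeta> (Suc k) a = subst_word \<zeta> (subst_iter \<zeta> k a)"
  by (simp add: subst_iter_def)

lemma length_subst_iter: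
  assumes "constant_length \<zeta> q"
  shows "length (subst_iter \<zeta> k a) = q ^ k"
  by (induction k) (simp_all add: subst_iter_0 subst_iter_Suc length_subst_word[OF assms])

lemma factor_eq_iff: "factor y i n = factor y j n \<longleftrightarrow> (\<forall>h<n. y (i + h) = y (j + h))"
  by (auto simp: factor_def list_eq_iff_nth_eq)

lemma bit_neq_neq: "a \<noteq> b \<Longrightarrow> c \<noteq> b \<Longrightarrow> a = c" for a b c :: bit
  by (cases a; cases b; cases c) auto

section \<open>The fixed point and its block structure\<close>

locale primitive_aperiodic_substitution =
  fixes \<zeta> :: substitution and q :: nat
  assumes q_ge_2: "q \<ge> 2"
    and const_len: "constant_length \<zeta> q"
    and prim: "primitive \<zeta>"
    and aper: "aperiodic \<zeta>"
    and hd_0: "hd (\<zeta> 0) = 0"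
begin

abbreviation x :: "nat \<Rightarrow> bit" where "x \<equiv> fixed_point \<zeta>"

abbreviation \<alpha> :: nat where "\<alpha> \<equiv> common_prefix_length \<zeta>"

abbreviation \<rho> :: nat where "\<rho> \<equiv> recognizability_const \<zeta> q"

lemma q_pos: "q > 0"
  using q_ge_2 by simp

lemma length_letter [simp]: "length (\<zeta> a) = q"
  using const_len by (simp add: constant_length_def)

lemma length_iter [simp]: "length (subst_iter \<zeta> k a) = q ^ k"
  using const_len by (rule length_subst_iter)

lemma less_power_q: "k < q ^ k"
  using q_ge_2 by (simp add: power_gt_expt)

text \<open>\<open>\<zeta> 0\<close> starts with \<open>0\<close>, and
  \<open>subst_word \<zeta>\<close> maps prefixes to prefixes.\<close>

lemma prefix_iter_Suc: "\<exists>v. subst_iter \<zeta> (Suc k) 0 = subst_iter \<zeta> k 0 @ v"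
proof (induction k)
  case 0
  have "\<zeta> 0 = 0 # tl (\<zeta> 0)"
    using hd_0 length_letter[of 0] q_pos by (metis hd_Cons_tl list.size(3) less_irrefl)
  then show ?case
    by (metis subst_iter_Suc subst_iter_0 subst_word_def append_Cons append_Nil append_Nil2
        concat.simps list.map)
next
  case (Suc k)
  then show ?case
    by (metis subst_iter_Suc subst_word_append)
qed

lemma prefix_iter: "k \<le> l \<Longrightarrow> \<exists>v. subst_iter \<zeta> l 0 = subst_iter \<zeta> k 0 @ v"
proof (induction l rule: dec_induct)
  case (step l)
  then show ?case
    using prefix_iter_Suc[of l] by auto
qed simp

text \<open>Eliminates the definite description: the iterates are nested prefixes, so a letter never
  changes once its position is covered. Hence the limit exists and is unique.\<close>

lemma fixed_point_eq_nth:
  assumes "i < q ^ k"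
  shows "x i = subst_iter \<zeta> k 0 ! i"
proof -
  \<comment> \<open>The diagonal is well defined because \<open>i < q ^ i\<close>.\<close>
  define y where "y i = subst_iter \<zeta> i 0 ! i" for i
  have agree: "subst_iter \<zeta> k 0 ! i = subst_iter \<zeta> l 0 ! i" if "i < q ^ k" "i < q ^ l" for i k l
  proof (cases "k \<le> l")
    case True
    then show ?thesis
      using prefix_iter[of k l] that by (auto simp: nth_append)
  next
    case False
    then show ?thesis
      using prefix_iter[of l k] that False by (auto simp: nth_append)
  qed
  have ev: "\<forall>\<^sub>F k in sequentially. i < q ^ k" for i
    by (rule eventually_sequentiallyI[of i]) (rule le_less_trans[OF _ less_power_q])
  have "x = y"
    unfolding fixed_point_def
  proof (rule the_equality)
    show "\<forall>i. \<forall>\<^sub>F k in sequentially. i < length (subst_iter \<zeta> k 0) \<and> subst_iter \<zeta> k 0 ! i = y i"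
    proof
      fix i
      show "\<forall>\<^sub>F k in sequentially. i < length (subst_iter \<zeta> k 0) \<and> subst_iter \<zeta> k 0 ! i = y i"
        using ev[of i] by eventually_elim (auto simp: y_def intro: agree less_power_q)
    qed
  next
    fix z
    assume z: "\<forall>i. \<forall>\<^sub>F k in sequentially. i < length (subst_iter \<zeta> k 0) \<and> subst_iter \<zeta> k 0 ! i = z i"
    show "z = y"
    proof
      fix i
      obtain k where "i < q ^ k" "subst_iter \<zeta> k 0 ! i = z i"
        using eventually_happens[OF z[rule_format, of i]] by auto
      then show "z i = y i"
        using agree[of i k i] less_power_q by (simp add: y_def)
    qed
  qed
  then show ?thesis
    by (simp add: y_def agree[OF less_power_q assms])
qed

lemma x_0: "x 0 = 0"
  using fixed_point_eq_nth[of 0 0] by (simp add: subst_iter_0)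

text \<open>The fixed point equation \<zeta>(x) = x, read in coordinates.\<close>

lemma x_mult_add:
  assumes "r < q"
  shows "x (q * m + r) = \<zeta> (x m) ! r"
proof -
  have "q * m + r < q * Suc m"
    using assms by simp
  also have "\<dots> \<le> q * q ^ m"
    using less_power_q[of m] by (intro mult_le_mono) auto
  finally have "x (q * m + r) = subst_iter \<zeta> (Suc m) 0 ! (q * m + r)"
    by (intro fixed_point_eq_nth) simp
  also have "\<dots> = \<zeta> (subst_iter \<zeta> m 0 ! m) ! r"
    using nth_subst_word[OF const_len _ assms] less_power_q by (simp add: subst_iter_Suc)
  finally show ?thesis
    using fixed_point_eq_nth[OF less_power_q] by simp
qed

lemma x_mult_add_iter: "r < q ^ k \<Longrightarrow> x (q ^ k * m + r) = subst_iter \<zeta> k (x m) ! r"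
proof (induction k arbitrary: r)
  case 0
  then show ?case by (simp add: subst_iter_0)
next
  case (Suc k)
  have r: "r = q * (r div q) + r mod q" and "r mod q < q"
    using q_pos by simp_all
  moreover have div: "r div q < q ^ k"
    using Suc.prems by (simp add: less_mult_imp_div_less mult.commute)
  ultimately have "subst_iter \<zeta> (Suc k) (x m) ! r = \<zeta> (subst_iter \<zeta> k (x m) ! (r div q)) ! (r mod q)"
    using nth_subst_word[OF const_len, of "r div q" "subst_iter \<zeta> k (x m)" "r mod q"]
    by (simp add: subst_iter_Suc)
  also have "\<dots> = x (q * (q ^ k * m + r div q) + r mod q)"
    using x_mult_add Suc.IH[OF div] \<open>r mod q < q\<close> by simp
  also have "q * (q ^ k * m + r div q) + r mod q = q ^ Suc k * m + r"
    by (simp add: algebra_simps)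
  finally show ?case by simp
qed

lemma iter_eq_factor: "subst_iter \<zeta> k (x m) = factor x (q ^ k * m) (q ^ k)"
  by (rule nth_equalityI) (auto simp: factor_def x_mult_add_iter)

lemma agree_mult:
  assumes "\<forall>m<n. x (i + m) = x (j + m)" and "h < q * n"
  shows "x (q * i + h) = x (q * j + h)"
proof -
  have "h div q < n"
    using assms(2) by (simp add: less_mult_imp_div_less mult.commute)
  moreover have "x (q * i + h) = \<zeta> (x (i + h div q)) ! (h mod q)" for i
    using x_mult_add[of "h mod q" "i + h div q"] q_pos by (simp add: algebra_simps)
  ultimately show ?thesis
    using assms(1) by simp
qed

section \<open>Language, uniform recurrence and aperiodicity\<close>

lemma letter_occurs_in_block: "\<exists>k. \<forall>m a. \<exists>r<q ^ k. x (q ^ k * m + r) = a"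
proof -
  obtain k where k: "\<forall>a b. b \<in> set (subst_iter \<zeta> k a)"
    using prim by (auto simp: primitive_def)
  have "\<exists>r<q ^ k. x (q ^ k * m + r) = a" for m a
    using k x_mult_add_iter[of _ k m] by (metis in_set_conv_nth length_iter)
  then show ?thesis by blast
qed

text \<open>Both letters occur in \<open>x\<close>, so every iterate of a letter is an aligned block
  of \<open>x\<close>; conversely, a factor of \<open>x\<close> lies in a sufficiently long prefix
  \<open>subst_iter \<zeta> k 0\<close>.\<close>

lemma language_iff: "w \<in> language \<zeta> \<longleftrightarrow> (\<exists>i. factor x i (length w) = w)"
proof
  assume "w \<in> language \<zeta>"
  then obtain k a where w: "sublist w (subst_iter \<zeta> k a)"
    by (auto simp: language_def)
  obtain m where "x m = a"
    using letter_occurs_in_block by blast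
  then obtain u v where "factor x (q ^ k * m) (q ^ k) = u @ w @ v"
    using w by (auto simp: sublist_def iter_eq_factor[symmetric])
  then have eq: "u @ w @ v = map x [q ^ k * m..<q ^ k * m + q ^ k]"
    by (simp add: factor_def)
  then have len: "length u + length w + length v = q ^ k"
    by (metis add.assoc add_diff_cancel_left' length_append length_map length_upt)
  have "factor x (q ^ k * m + length u) (length w) = w"
  proof (rule nth_equalityI)
    fix h
    assume "h < length (factor x (q ^ k * m + length u) (length w))"
    then have "h < length w"
      by (simp add: factor_def)
    moreover have "w ! h = (u @ w @ v) ! (length u + h)"
      using calculation by (simp add: nth_append)
    ultimately show "factor x (q ^ k * m + length u) (length w) ! h = w ! h"
      unfolding eq using len by (simp add: factor_def add.assoc)
  qed (simp add: factor_def)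
  then show "\<exists>i. factor x i (length w) = w" ..
next
  assume "\<exists>i. factor x i (length w) = w"
  then obtain i where i: "factor x i (length w) = w" ..
  define N where "N = q ^ (i + length w)"
  have "i + length w \<le> N"
    using less_power_q[of "i + length w"] by (simp add: N_def)
  then obtain e where "N = i + length w + e"
    using le_Suc_ex by blast
  then have "[0..<N] = [0..<i] @ [i..<i + length w] @ [i + length w..<N]"
    using upt_add_eq_append[of 0 "i + length w" e] upt_add_eq_append[of 0 i "length w"] by simp
  then have "subst_iter \<zeta> (i + length w) 0 = map x [0..<i] @ w @ map x [i + length w..<N]"
    using iter_eq_factor[of "i + length w" 0] x_0 i
    by (simp add: factor_def N_def)
  then have "sublist w (subst_iter \<zeta> (i + length w) 0)"
    by (auto simp: sublist_def)
  then show "w \<in> language \<zeta>"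
    by (auto simp: language_def)
qed

text \<open>The finitely many factors of length \<open>L\<close> all occur in one prefix
  \<open>subst_iter \<zeta> K 0\<close>. By primitivity the letter \<open>0\<close> has bounded
  gaps, hence so do the copies of this prefix.\<close>

lemma uniformly_recurrent:
  "\<exists>M. \<forall>i j. \<exists>k. k + L \<le> M \<and> (\<forall>m<L. x (i + m) = x (j + k + m))"
proof -
  define W where "W = (\<lambda>i. factor x i L) ` UNIV"
  have "W \<subseteq> {w. set w \<subseteq> UNIV \<and> length w = L}"
    by (auto simp: W_def factor_def)
  moreover have "(UNIV :: bit set) = {0, 1}"
    using bit.exhaust by auto
  then have "finite (UNIV :: bit set)"
    by (metis finite.emptyI finite_insert)
  ultimately have "finite W"
    using finite_lists_length_eq finite_subset by blast
  then obtain C where C: "finite C" "W = (\<lambda>i. factor x i L) ` C"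
    unfolding W_def by (meson finite_subset_image subset_refl)
  then obtain P where P: "\<forall>c\<in>C. c \<le> P"
    using finite_nat_set_iff_bounded_le by blast
  define K where "K = P + L"
  have K: "P + L \<le> q ^ K"
    using less_power_q[of K] by (simp add: K_def)
  obtain k where k: "\<forall>m a. \<exists>r<q ^ k. x (q ^ k * m + r) = a"
    using letter_occurs_in_block by blast
  define Q where "Q = q ^ K * q ^ k"
  have "Q > 0"
    using q_pos by (simp add: Q_def)
  have "\<exists>l. l + L \<le> 2 * Q \<and> (\<forall>m<L. x (i + m) = x (j + l + m))" for i j
  proof -
    have "factor x i L \<in> W"
      by (simp add: W_def)
    then obtain c where c: "c \<in> C" "factor x i L = factor x c L"
      using C by auto
    \<comment> \<open>Selects the first aligned block of length \<open>Q\<close> that begins after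
      \<open>j\<close>; it ends at most \<open>2 * Q\<close> after \<open>j\<close>.\<close>
    define m where "m = Suc (j div Q)"
    have j: "j < Q * m" "Q * m \<le> j + Q"
      using \<open>Q > 0\<close> dividend_less_times_div[of Q j] by (simp_all add: m_def)
    obtain r where r: "r < q ^ k" "x (q ^ k * m + r) = 0"
      using k by blast
    define e where "e = q ^ K * (q ^ k * m + r)"
    have e: "e = Q * m + q ^ K * r"
      by (simp add: e_def Q_def algebra_simps)
    have "q ^ K * r + q ^ K \<le> Q"
      using mult_le_mono2[of "Suc r" "q ^ k" "q ^ K"] r by (simp add: Q_def)
    moreover have "c + L \<le> q ^ K"
      using K P c by fastforce
    ultimately have "e + c - j + L \<le> 2 * Q"
      using j e by linarith
    moreover have "x (i + h) = x (j + (e + c - j) + h)" if "h < L" for h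
    proof -
      have "c + h < q ^ K"
        using that \<open>c + L \<le> q ^ K\<close> by simp
      then have "x (e + (c + h)) = x (c + h)"
        using x_mult_add_iter[of "c + h" K "q ^ k * m + r"] x_mult_add_iter[of "c + h" K 0] r x_0
        by (simp add: e_def)
      moreover have "x (i + h) = x (c + h)"
        using c(2) that by (simp add: factor_eq_iff)
      ultimately show ?thesis
        using j e by (simp add: add.assoc)
    qed
    ultimately show ?thesis by blast
  qed
  then show ?thesis by blast
qed

text \<open>By uniform recurrence a long enough word of period \<open>p\<close> contains every
  factor of length \<open>p + 1\<close>. Then \<open>x\<close> has period \<open>p\<close>, and so
  has every member of \<open>subst_space \<zeta>\<close>.\<close>

lemma no_long_period:
  assumes "p \<ge> 1"
  shows "\<exists>L. \<forall>i. \<exists>m<L. x (i + m) \<noteq> x (i + p + m)"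
proof (rule ccontr)
  assume "\<not> ?thesis"
  then have long: "\<exists>i. \<forall>m<L. x (i + m) = x (i + p + m)" for L
    by blast
  have per: "x (j + p) = x j" for j
  proof -
    \<comment> \<open>Length \<open>p + 1\<close> lets one word contain both positions
      \<open>j\<close> and \<open>j + p\<close>.\<close>
    obtain M where M: "\<forall>i j. \<exists>k. k + (p + 1) \<le> M \<and> (\<forall>m<p + 1. x (i + m) = x (j + k + m))"
      using uniformly_recurrent by blast
    obtain i where i: "\<forall>m<M. x (i + m) = x (i + p + m)"
      using long by blast
    obtain k where k: "k + (p + 1) \<le> M" "\<forall>m<p + 1. x (j + m) = x (i + k + m)"
      using M by blast
    then have "x (i + k) = x (i + p + k)"
      using i by simp
    then show ?thesis
      using k(2)[rule_format, of 0] k(2)[rule_format, of p] by (simp add: ac_simps)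
  qed
  have "shift_periodic y" if y: "y \<in> subst_space \<zeta>" for y
    unfolding shift_periodic_def
  proof (intro exI conjI allI)
    fix j
    have "factor y 0 (j + p + 1) \<in> language \<zeta>"
      using y by (simp add: subst_space_def)
    then obtain i where i: "factor x i (length (factor y 0 (j + p + 1))) = factor y 0 (j + p + 1)"
      by (auto simp: language_iff)
    have "y h = x (i + h)" if "h < j + p + 1" for h
      using arg_cong[OF i, of "\<lambda>w. w ! h"] that by (simp add: factor_def del: upt_Suc)
    then show "y (j + p) = y j"
      using per[of "i + j"] by (simp add: add.assoc)
  qed (rule assms)
  then show False
    using aper by (auto simp: aperiodic_def)
qed

text \<open>The periods met below depend on the positions but never exceed \<open>2 * q\<close>, so
  one length must serve all of them.\<close>

lemma bounded_period:
  "\<exists>L. \<forall>p i. 1 \<le> p \<longrightarrow> p \<le> B \<longrightarrow> (\<exists>m<L. x (i + m) \<noteq> x (i + p + m))"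
proof -
  have "\<forall>p\<in>{1..B}. \<exists>L. \<forall>i. \<exists>m<L. x (i + m) \<noteq> x (i + p + m)"
    using no_long_period by simp
  then obtain f where f: "\<forall>p\<in>{1..B}. \<forall>i. \<exists>m<f p. x (i + m) \<noteq> x (i + p + m)"
    by metis
  define L where "L = Max (f ` {1..B})"
  have "f p \<le> L" if "p \<in> {1..B}" for p
    using that by (simp add: L_def)
  then show ?thesis
    using f by (meson atLeastAtMost_iff less_le_trans)
qed

section \<open>The two letter images and recognizability of long words\<close>

lemma letters_neq: "\<zeta> 0 \<noteq> \<zeta> 1"
proof
  assume eq: "\<zeta> 0 = \<zeta> 1"
  have const: "\<zeta> a = \<zeta> b" for a b
    using eq by (cases a; cases b) auto
  \<comment> \<open>With equal images every block of length \<open>q\<close> is the same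
    word.\<close>
  have "x (i + m) = x (i + q + m)" for i m
    using x_mult_add[of "(i + m) mod q" "(i + m) div q"] x_mult_add[of "(i + m) mod q" "Suc ((i + m) div q)"]
      q_pos const[of "x ((i + m) div q)" "x (Suc ((i + m) div q))"] by (simp add: algebra_simps)
  then show False
    using no_long_period[of q] q_pos by auto
qed

text \<open>The images have equal length and differ, so their common prefix is proper, and by
  maximality the next letters differ. Position \<open>\<alpha>\<close> of a block thus determines
  its preimage letter.\<close>

lemma common_prefix:
  shows common_prefix_less: "\<alpha> < q"
    and nth_common_prefix: "h < \<alpha> \<Longrightarrow> \<zeta> a ! h = \<zeta> b ! h"
    and nth_common_prefix_length: "a \<noteq> b \<Longrightarrow> \<zeta> a ! \<alpha> \<noteq> \<zeta> b ! \<alpha>"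
proof -
  let ?p = "longest_common_prefix (\<zeta> 0) (\<zeta> 1)"
  have len: "length ?p = \<alpha>"
    by (simp add: common_prefix_length_def)
  obtain u v where u: "\<zeta> 0 = ?p @ u" and v: "\<zeta> 1 = ?p @ v"
    using longest_common_prefix_prefix1 longest_common_prefix_prefix2 by (metis prefixE)
  have "u \<noteq> v"
    using letters_neq u v by metis
  moreover have "length u = length v"
    using u v by (metis length_letter length_append add_left_cancel)
  ultimately obtain a u' b v' where uv: "u = a # u'" "v = b # v'"
    by (cases u; cases v) auto
  have "a \<noteq> b"
  proof
    assume "a = b"
    then have "prefix (?p @ [a]) (\<zeta> 0)" "prefix (?p @ [a]) (\<zeta> 1)"
      using u v uv by (metis append.assoc append_Cons append_Nil prefixI)+
    then have "prefix (?p @ [a]) ?p"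
      by (rule longest_common_prefix_max_prefix)
    then show False
      by (simp add: prefix_def)
  qed
  show "\<alpha> < q"
    using arg_cong[OF u, of length] uv len by simp
  have "\<zeta> 0 ! h = \<zeta> 1 ! h" if "h < \<alpha>" for h
    using that u v len by (metis nth_append)
  then show "h < \<alpha> \<Longrightarrow> \<zeta> a ! h = \<zeta> b ! h" for a b
    by (cases a; cases b) auto
  have "\<zeta> 0 ! \<alpha> \<noteq> \<zeta> 1 ! \<alpha>"
    using u v uv len \<open>a \<noteq> b\<close> by (metis nth_append_length)
  then show "a \<noteq> b \<Longrightarrow> \<zeta> a ! \<alpha> \<noteq> \<zeta> b ! \<alpha>" for a b
    by (cases a; cases b) auto
qed

text \<open>Complementing twice is the identity. Recurrence places the word at \<open>a\<close> also
  at \<open>b + k\<close>, and the word at \<open>b\<close> at \<open>a + k\<close>. Going from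
  \<open>q * a\<close> to \<open>q * b\<close> and back uses the shift by \<open>t\<close> twice,
  giving the forbidden period \<open>2 * t\<close>.\<close>

lemma no_shifted_complement:
  "\<exists>R. \<forall>a b t. 0 < t \<longrightarrow> t \<le> q \<longrightarrow> (\<forall>m<R. x (a + m) \<noteq> x (b + m)) \<longrightarrow>
     \<not> (\<forall>h<R. x (q * b + t + h) = x (q * a + h))"
proof -
  obtain P where P: "\<forall>p i. 1 \<le> p \<longrightarrow> p \<le> 2 * q \<longrightarrow> (\<exists>m<P. x (i + m) \<noteq> x (i + p + m))"
    using bounded_period by blast
  \<comment> \<open>The summand \<open>2 * q\<close> makes room for the double shift, as
    \<open>t \<le> q\<close>.\<close>
  define L where "L = P + 2 * q"
  obtain M where M: "\<forall>i j. \<exists>k. k + L \<le> M \<and> (\<forall>m<L. x (i + m) = x (j + k + m))"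
    using uniformly_recurrent by blast
  have "\<not> (\<forall>h<q * M. x (q * b + t + h) = x (q * a + h))"
    if t: "0 < t" "t \<le> q" and compl: "\<forall>m<q * M. x (a + m) \<noteq> x (b + m)" for a b t
  proof
    assume shift: "\<forall>h<q * M. x (q * b + t + h) = x (q * a + h)"
    obtain k where k: "k + L \<le> M" "\<forall>m<L. x (a + m) = x (b + k + m)"
      using M by blast
    have "M \<le> q * M" "L \<le> q * L"
      using q_pos by simp_all
    \<comment> \<open>Complementation occurs at \<open>a\<close> and at \<open>a + k\<close>, so the two words are exchanged again.\<close>
    have k': "\<forall>m<L. x (a + k + m) = x (b + m)"
    proof (intro allI impI)
      fix m
      assume "m < L"
      moreover have "k + m < q * M" "m < q * M"
        using \<open>m < L\<close> k(1) \<open>M \<le> q * M\<close> by linarith+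
      then have "x (a + k + m) \<noteq> x (b + k + m)" "x (a + m) \<noteq> x (b + m)"
        using compl by (simp_all add: add.assoc)
      ultimately show "x (a + k + m) = x (b + m)"
        using k(2) bit_neq_neq by metis
    qed
    have period: "x (q * a + h) = x (q * a + 2 * t + h)" if "h < P" for h
    proof -
      have h: "2 * t + h < q * L"
        using that t(2) \<open>L \<le> q * L\<close> L_def by linarith
      have le: "q * k + q * L \<le> q * M"
        using k(1) by (metis add_mult_distrib2 mult_le_mono2)
      have "x (q * a + (2 * t + h)) = x (q * (b + k) + (2 * t + h))"
        using agree_mult[OF k(2)] h by simp
      also have "q * (b + k) + (2 * t + h) = q * b + t + (q * k + t + h)"
        by (simp add: algebra_simps)
      also have "x (q * b + t + (q * k + t + h)) = x (q * a + (q * k + t + h))"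
        using shift h le by simp
      also have "\<dots> = x (q * (a + k) + (t + h))"
        by (simp add: algebra_simps)
      also have "\<dots> = x (q * b + (t + h))"
        using agree_mult[OF k'] h by simp
      also have "\<dots> = x (q * a + h)"
        using shift h le by (simp add: add.assoc)
      finally show ?thesis
        by (simp add: add.assoc)
    qed
    then show False
      using P[rule_format, of "2 * t" "q * a"] t by auto
  qed
  then show ?thesis by blast
qed

text \<open>
  Reading off \<open>\<zeta>(x\<^bsub>a+m\<^esub>)\<close> at the first position \<open>\<alpha>\<close> where \<open>\<zeta>(0)\<close> and \<open>\<zeta>(1)\<close> differ shows that
  \<open>x\<^bsub>a+m\<^esub>\<close> depends on a single letter \<open>x\<^bsub>b+c+m\<^esub>\<close>. The dependence is constant, the identity or
  complementation, and each case produces a long word with a small period.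
\<close>

lemma no_misaligned_agreement:
  "\<exists>R. \<forall>a b t. 0 < t \<longrightarrow> t < q \<longrightarrow> \<not> (\<forall>h<R. x (q * a + h) = x (q * b + t + h))"
proof -
  obtain P where P: "\<forall>p i. 1 \<le> p \<longrightarrow> p \<le> q \<longrightarrow> (\<exists>m<P. x (i + m) \<noteq> x (i + p + m))"
    using bounded_period by blast
  obtain S where S: "\<forall>a b t. 0 < t \<longrightarrow> t \<le> q \<longrightarrow> (\<forall>m<S. x (a + m) \<noteq> x (b + m)) \<longrightarrow>
     \<not> (\<forall>h<S. x (q * b + t + h) = x (q * a + h))"
    using no_shifted_complement by blast
  define R where "R = P + S + q"
  have R: "R \<le> q * R"
    using q_pos by simp
  have False if t: "0 < t" "t < q" and H: "\<forall>h<q * R. x (q * a + h) = x (q * b + t + h)" for a b t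
  proof -
    \<comment> \<open>Position \<open>\<alpha>\<close> of block \<open>a + m\<close> is matched with
      offset \<open>t + \<alpha>\<close> from the start of block \<open>b + m\<close>, that is, with
      position \<open>e\<close> of block \<open>b + c + m\<close>.\<close>
    define c where "c = (t + \<alpha>) div q"
    define e where "e = (t + \<alpha>) mod q"
    have ce: "t + \<alpha> = q * c + e" and "e < q"
      using q_pos by (simp_all add: c_def e_def)
    have "q * c < q * 2"
      using ce t common_prefix_less by linarith
    then have c: "c = 0 \<or> c = 1"
      by auto
    have letter: "\<zeta> (x (a + m)) ! \<alpha> = \<zeta> (x (b + c + m)) ! e" if "m < R" for m
    proof -
      have "q * m + \<alpha> < q * R"
        using that common_prefix_less mult_le_mono2[of "Suc m" R q] by simp
      then have "x (q * a + (q * m + \<alpha>)) = x (q * b + t + (q * m + \<alpha>))"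
        using H by blast
      also have "q * b + t + (q * m + \<alpha>) = q * (b + c + m) + e"
        using ce by (simp add: algebra_simps)
      also have "q * a + (q * m + \<alpha>) = q * (a + m) + \<alpha>"
        by (simp add: algebra_simps)
      finally show ?thesis
        using x_mult_add common_prefix_less \<open>e < q\<close> by simp
    qed
    consider (const) "\<And>u v. \<zeta> u ! e = \<zeta> v ! e"
      | (same) "\<And>u v. \<zeta> u ! \<alpha> = \<zeta> v ! e \<Longrightarrow> u = v"
      | (compl) "\<And>u v. \<zeta> u ! \<alpha> = \<zeta> v ! e \<Longrightarrow> u \<noteq> v"
    proof (cases "\<zeta> 0 ! e = \<zeta> 1 ! e")
      case True
      then have "\<zeta> u ! e = \<zeta> v ! e" for u v
        by (cases u; cases v) auto
      then show ?thesis by (rule const)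
    next
      case False
      have differ: "\<zeta> 0 ! \<alpha> \<noteq> \<zeta> 1 ! \<alpha>"
        by (rule nth_common_prefix_length) simp
      show ?thesis
      proof (cases "\<zeta> 0 ! \<alpha> = \<zeta> 0 ! e")
        case True
        then have "\<zeta> u ! \<alpha> = \<zeta> v ! e \<Longrightarrow> u = v" for u v
          using differ False by (cases u; cases v) auto
        then show ?thesis by (rule same)
      next
        case ne: False
        then have "\<zeta> 1 ! \<alpha> \<noteq> \<zeta> 1 ! e"
          using differ False ne bit_neq_neq[of "\<zeta> 1 ! \<alpha>" "\<zeta> 0 ! \<alpha>" "\<zeta> 0 ! e"] by auto
        with ne have "\<zeta> u ! \<alpha> = \<zeta> v ! e \<Longrightarrow> u \<noteq> v" for u v
          by (cases u; cases v) auto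
        then show ?thesis by (rule compl)
      qed
    qed
    then show False
    proof cases
      case const
      have "x (a + m) = x (a + 1 + m)" if "m < P" for m
      proof (rule ccontr)
        assume "x (a + m) \<noteq> x (a + 1 + m)"
        then have "\<zeta> (x (a + m)) ! \<alpha> \<noteq> \<zeta> (x (a + Suc m)) ! \<alpha>"
          by (intro nth_common_prefix_length) simp
        moreover have "m < R" "Suc m < R"
          using that q_pos t by (simp_all add: R_def)
        ultimately show False
          using letter const by metis
      qed
      then show False
        using P[rule_format, of 1 a] q_pos by auto
    next
      case same
      have "\<forall>m<R. x (a + m) = x (b + c + m)"
        using letter same by blast
      then have "x (q * a + h) = x (q * (b + c) + h)" if "h < q * R" for h
        using agree_mult that by blast
      \<comment> \<open>The block at \<open>q * a\<close> is matched with two places near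
        \<open>q * b\<close>, at offsets \<open>t\<close> and \<open>q * c\<close>; their distance
        is \<open>t\<close> or \<open>q - t\<close>, a period below \<open>q\<close>.\<close>
      then have eq: "x (q * b + t + h) = x (q * b + q * c + h)" if "h < P" for h
        using H that R by (simp add: algebra_simps R_def)
      show False
        using c
      proof
        assume "c = 0"
        then show False
          using eq P[rule_format, of t "q * b"] t by auto
      next
        assume "c = 1"
        then show False
          using eq P[rule_format, of "q - t" "q * b + t"] t by fastforce
      qed
    next
      case compl
      have neq: "x (a + m) \<noteq> x (b + c + m)" if "m < R" for m
        using letter compl that by blast
      show False
        using c
      proof
        assume "c = 0"
        then have "\<forall>m<S. x (a + m) \<noteq> x (b + m)"
          using neq by (simp add: R_def)
        moreover have "S \<le> q * R"
          using R R_def by linarith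
        then have "\<forall>h<S. x (q * b + t + h) = x (q * a + h)"
          using H by simp
        ultimately show False
          using S t by (meson less_imp_le)
      next
        assume "c = 1"
        \<comment> \<open>For \<open>c = 1\<close> the roles are swapped: \<open>b + 1\<close>
          replaces \<open>a\<close>, \<open>a\<close> replaces \<open>b\<close>, and the shift
          becomes \<open>q - t\<close>.\<close>
        then have "\<forall>m<S. x (b + 1 + m) \<noteq> x (a + m)"
          using neq by (metis R_def trans_less_add1 trans_less_add2)
        moreover have "x (q * a + (q - t) + h) = x (q * (b + 1) + h)" if "h < S" for h
        proof -
          have "q - t + h < q * R"
            using that R R_def t by linarith
          then have "x (q * a + (q - t + h)) = x (q * b + t + (q - t + h))"
            using H by blast
          then show ?thesis
            using t by (simp add: algebra_simps)
        qed
        ultimately show False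
          using S[rule_format, of "q - t" "b + 1" a] t by auto
      qed
    qed
  qed
  then show ?thesis by blast
qed

text \<open>Moving both positions forward until the first is a multiple of \<open>q\<close> reduces
  this to the misaligned case.\<close>

lemma long_agreement_imp_cong:
  "\<exists>N. \<forall>i j. (\<forall>h<N. x (i + h) = x (j + h)) \<longrightarrow> i mod q = j mod q"
proof -
  obtain R where R: "\<forall>a b t. 0 < t \<longrightarrow> t < q \<longrightarrow> \<not> (\<forall>h<R. x (q * a + h) = x (q * b + t + h))"
    using no_misaligned_agreement by blast
  have "i mod q = j mod q" if agree: "\<forall>h<q + R. x (i + h) = x (j + h)" for i j
  proof (rule ccontr)
    assume neq: "i mod q \<noteq> j mod q"
    \<comment> \<open>For aligned \<open>i\<close> this gives \<open>q\<close> and not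
      \<open>0\<close>; in all cases \<open>d \<le> q\<close>, which the summand \<open>q\<close> in
      the length of agreement absorbs.\<close>
    define d where "d = q - i mod q"
    define a where "a = Suc (i div q)"
    have id: "i + d = q * a"
      using q_pos mult_div_mod_eq[of q i] mod_less_divisor[OF q_pos, of i]
      unfolding a_def d_def mult_Suc_right by linarith
    define b where "b = (j + d) div q"
    define t where "t = (j + d) mod q"
    have jd: "j + d = q * b + t"
      by (simp add: b_def t_def)
    have "t \<noteq> 0"
    proof
      assume "t = 0"
      then have "(j + d) mod q = (i + d) mod q"
        unfolding id by (simp add: t_def)
      then have "(j + d + i mod q) mod q = (i + d + i mod q) mod q"
        by (rule mod_add_cong) (rule refl)
      moreover have "d + i mod q = q"
        using q_pos by (simp add: d_def)
      ultimately show False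
        using neq by (simp add: add.assoc)
    qed
    moreover have "t < q"
      using q_pos by (simp add: t_def)
    moreover have "x (q * a + h) = x (q * b + t + h)" if "h < R" for h
      using agree[rule_format, of "d + h"] that id jd by (simp add: d_def add.assoc[symmetric])
    ultimately show False
      using R by blast
  qed
  then show ?thesis by blast
qed

section \<open>The recognizability constant\<close>

lemma recognizable_iff:
  "recognizable \<zeta> q w \<longleftrightarrow> w \<noteq> [] \<and> w \<in> language \<zeta> \<and>
     (\<forall>i j. factor x i (length w) = w \<longrightarrow> factor x j (length w) = w \<longrightarrow> i mod q = j mod q)"
proof -
  have class_iff: "i \<in> {q * m + p |m. True} \<longleftrightarrow> i mod q = p" if "p < q" for i p
    using that by (auto intro: exI[of _ "i div q"])
  have "(\<exists>!p. p < q \<and> {i. factor x i (length w) = w} \<subseteq> {q * m + p |m. True}) \<longleftrightarrow>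
      (\<forall>i j. factor x i (length w) = w \<longrightarrow> factor x j (length w) = w \<longrightarrow> i mod q = j mod q)"
    if w: "w \<in> language \<zeta>"
  proof -
    \<comment> \<open>Since an occurrence exists, its residue is the only candidate for
      \<open>p\<close>.\<close>
    obtain i where i: "factor x i (length w) = w"
      using w language_iff by blast
    have "p < q \<and> {i. factor x i (length w) = w} \<subseteq> {q * m + p |m. True} \<longleftrightarrow>
        p < q \<and> (\<forall>j. factor x j (length w) = w \<longrightarrow> j mod q = p)" for p
      unfolding subset_eq Ball_Collect[symmetric] Ball_def using class_iff[of p] by auto
    then have "(\<exists>!p. p < q \<and> {i. factor x i (length w) = w} \<subseteq> {q * m + p |m. True}) \<longleftrightarrow>
        (\<exists>!p. p < q \<and> (\<forall>j. factor x j (length w) = w \<longrightarrow> j mod q = p))"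
      by simp
    also have "\<dots> \<longleftrightarrow>
        (\<forall>i j. factor x i (length w) = w \<longrightarrow> factor x j (length w) = w \<longrightarrow> i mod q = j mod q)"
      using i mod_less_divisor[OF q_pos] by metis
    finally show ?thesis .
  qed
  then show ?thesis
    unfolding recognizable_def by blast
qed

text \<open>All sufficiently long words are recognizable, so the \<open>LEAST\<close> is taken over
  a nonempty set and \<open>\<rho>\<close> has its defining property.\<close>

lemma recognizability_const:
  shows common_prefix_less_const: "\<alpha> < \<rho>"
    and agree_imp_cong: "\<forall>h<\<rho>. x (i + h) = x (j + h) \<Longrightarrow> i mod q = j mod q"
proof -
  let ?P = "\<lambda>r. \<alpha> + common_suffix_length \<zeta> < r \<and>
    (\<forall>w \<in> language \<zeta>. r \<le> length w \<longrightarrow> recognizable \<zeta> q w)"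
  obtain N where N: "\<forall>i j. (\<forall>h<N. x (i + h) = x (j + h)) \<longrightarrow> i mod q = j mod q"
    using long_agreement_imp_cong by blast
  have "recognizable \<zeta> q w"
    if w: "w \<in> language \<zeta>" "N + \<alpha> + common_suffix_length \<zeta> + 1 \<le> length w" for w
    unfolding recognizable_iff
  proof (intro conjI allI impI)
    fix i j
    assume "factor x i (length w) = w" "factor x j (length w) = w"
    then have "factor x i (length w) = factor x j (length w)"
      by simp
    then show "i mod q = j mod q"
      using N w(2) by (simp add: factor_eq_iff)
  qed (use w in auto)
  then have "?P (N + \<alpha> + common_suffix_length \<zeta> + 1)"
    by auto
  then have P: "?P \<rho>"
    unfolding recognizability_const_def by (rule LeastI)
  then show "\<alpha> < \<rho>"
    by simp
  assume agree: "\<forall>h<\<rho>. x (i + h) = x (j + h)"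
  have len: "length (factor x i \<rho>) = \<rho>"
    by (simp add: factor_def)
  then have "factor x i \<rho> \<in> language \<zeta>"
    unfolding language_iff by auto
  then have "recognizable \<zeta> q (factor x i \<rho>)"
    using P len by simp
  moreover have "factor x j \<rho> = factor x i \<rho>"
    using agree by (simp add: factor_eq_iff)
  ultimately show "i mod q = j mod q"
    unfolding recognizable_iff len by blast
qed

section \<open>Desubstitution of boundary lines\<close>

text \<open>If \<open>x\<close> and its shift by \<open>j\<close> first differ at \<open>l'\<close>,
  their images agree on \<open>l'\<close> whole blocks and on the common prefix of the next block,
  then differ.\<close>

lemma agreement_length_desubst:
  assumes "\<forall>h<l. x h = x (q * j + h)" and "x l \<noteq> x (q * j + l)"
  shows "\<exists>l'. l = q * l' + \<alpha> \<and> (\<forall>h<l'. x h = x (j + h)) \<and> x l' \<noteq> x (j + l')"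
proof -
  define l' where "l' = (LEAST h. x h \<noteq> x (j + h))"
  \<comment> \<open>Agreement on \<open>Suc l\<close> letters would give agreement of the images on
    \<open>q * Suc l\<close> letters, beyond position \<open>l\<close>.\<close>
  have "\<exists>h. x h \<noteq> x (j + h)"
  proof (rule ccontr)
    assume "\<not> ?thesis"
    then show False
      using agree_mult[of "Suc l" 0 j l] assms(2) n_less_m_mult_n[of "Suc l" q] q_ge_2 by simp
  qed
  then have neq: "x l' \<noteq> x (j + l')"
    unfolding l'_def by (rule LeastI_ex)
  have agree: "\<forall>h<l'. x h = x (j + h)"
    unfolding l'_def using not_less_Least by blast
  have split: "x (q * l' + r) = \<zeta> (x l') ! r" "x (q * j + (q * l' + r)) = \<zeta> (x (j + l')) ! r"
    if "r < q" for r
    using x_mult_add[OF that, of l'] x_mult_add[OF that, of "j + l'"]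
    by (simp_all add: algebra_simps)
  have "x (q * l' + \<alpha>) \<noteq> x (q * j + (q * l' + \<alpha>))"
    using split[OF common_prefix_less] nth_common_prefix_length[OF neq] by simp
  then have "l \<le> q * l' + \<alpha>"
    using assms(1) not_le by blast
  moreover have "x h = x (q * j + h)" if "h < q * l' + \<alpha>" for h
  proof (cases "h < q * l'")
    case True
    then show ?thesis
      using agree_mult[of l' 0 j h] agree by simp
  next
    case False
    then have "h = q * l' + (h - q * l')" "h - q * l' < \<alpha>"
      using that by simp_all
    then show ?thesis
      using split[of "h - q * l'"] common_prefix_less nth_common_prefix by (metis less_trans)
  qed
  then have "q * l' + \<alpha> \<le> l"
    using assms(2) not_le by blast
  ultimately show ?thesis
    using agree neq by auto
qed

text \<open>While \<open>l \<ge> \<rho>\<close>, the common word occurs at \<open>0\<close> and at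
  \<open>j\<close>, so recognizability makes \<open>j\<close> divisible by \<open>q\<close>. Each
  desubstitution divides \<open>j\<close> by \<open>q\<close>, whence
  \<open>q ^ k \<le> j\<close>.\<close>

lemma agreement_length_eq_iterate:
  assumes "j \<ge> 1" and "l \<ge> 1" and "\<forall>h<l. x h = x (j + h)" and "x l \<noteq> x (j + l)"
  shows "\<exists>k l'. q ^ k \<le> j \<and> 1 \<le> l' \<and> l' < \<rho> \<and> l = ((\<lambda>l. q * l + \<alpha>) ^^ k) l'"
  using assms
proof (induction j arbitrary: l rule: less_induct)
  case (less j)
  show ?case
  proof (cases "l < \<rho>")
    case True
    then show ?thesis
      using less.prems by (intro exI[of _ 0] exI[of _ l]) simp
  next
    case False
    then have "j mod q = 0"
      using agree_imp_cong[of 0 j] less.prems(3) by simp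
    then obtain j' where j': "j = q * j'"
      by auto
    obtain l' where l': "l = q * l' + \<alpha>" "\<forall>h<l'. x h = x (j' + h)" "x l' \<noteq> x (j' + l')"
      using agreement_length_desubst less.prems(3,4) unfolding j' by blast
    \<comment> \<open>Otherwise \<open>l = \<alpha>\<close>, but
      \<open>\<alpha> < \<rho> \<le> l\<close>.\<close>
    have "l' \<ge> 1"
      using False l'(1) common_prefix_less_const by (cases l') auto
    have "j' \<ge> 1" "j' < j"
      using less.prems(1) j' q_ge_2 by auto
    then obtain k m where "q ^ k \<le> j'" "1 \<le> m" "m < \<rho>" "l' = ((\<lambda>l. q * l + \<alpha>) ^^ k) m"
      using less.IH[OF _ _ \<open>l' \<ge> 1\<close> l'(2,3)] by blast
    then show ?thesis
      using l'(1) j' by (intro exI[of _ "Suc k"] exI[of _ m]) simp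
  qed
qed

lemma zero_boundary_line_length_eq_iterate:
  assumes "l \<in> zero_boundary_line_lengths x n"
  shows "\<exists>k l'. q ^ k < n \<and> 1 \<le> l' \<and> l' < \<rho> \<and> l = ((\<lambda>l. q * l + \<alpha>) ^^ k) l'"
proof -
  obtain i j where ij: "i < n" "j < n" "zero_boundary_line x i j l"
    using assms by (auto simp: zero_boundary_line_lengths_def)
  define d where "d = max i j"
  have d: "1 \<le> d" "d < n" "(i = 0 \<and> j = d) \<or> (i = d \<and> j = 0)"
    using ij by (auto simp: d_def zero_boundary_line_def min_def max_def split: if_splits)
  have "l \<ge> 1" "\<forall>h<l. x (i + h) = x (j + h)" "x (i + l) \<noteq> x (j + l)"
    using ij(3) by (auto simp: zero_boundary_line_def recurrence_plot_def split: if_splits)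
  then have "\<forall>h<l. x h = x (d + h)" "x l \<noteq> x (d + l)"
    using d(3) by (metis add_0)+
  then show ?thesis
    using agreement_length_eq_iterate[OF d(1) \<open>l \<ge> 1\<close>] d(2) le_less_trans by blast
qed

section \<open>Size and number of the lengths\<close>

text \<open>As \<open>\<alpha> < q\<close>, one step at most multiplies the successor of the length
  by \<open>q\<close>.\<close>

lemma iterate_less: "((\<lambda>l. q * l + \<alpha>) ^^ k) l < q ^ k * Suc l"
proof (induction k)
  case (Suc k)
  have "((\<lambda>l. q * l + \<alpha>) ^^ Suc k) l < q * Suc (((\<lambda>l. q * l + \<alpha>) ^^ k) l)"
    using common_prefix_less by simp
  also have "\<dots> \<le> q * (q ^ k * Suc l)"
    using Suc by (intro mult_le_mono2) simp
  finally show ?case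
    by (simp only: power_Suc mult.assoc)
qed simp

theorem zero_boundary_line_length_less:
  assumes "l \<in> zero_boundary_line_lengths x n"
  shows "l < \<rho> * n"
proof -
  obtain k l' where k: "q ^ k < n" "l' < \<rho>" "l = ((\<lambda>l. q * l + \<alpha>) ^^ k) l'"
    using zero_boundary_line_length_eq_iterate[OF assms] by blast
  have "l < q ^ k * Suc l'"
    using iterate_less k(3) by simp
  also have "\<dots> \<le> n * \<rho>"
    using k by (intro mult_le_mono) auto
  finally show ?thesis
    by (simp add: mult.commute)
qed

text \<open>A length is determined by a pair \<open>(k, l')\<close>, with \<open>\<rho> - 1\<close>
  choices for \<open>l'\<close> and at most \<open>1 + log (real q) (real n)\<close> for
  \<open>k\<close>.\<close>

theorem card_zero_boundary_line_lengths:
  assumes "n \<ge> 1"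
  shows "real (card (zero_boundary_line_lengths x n)) \<le> (real \<rho> - 1) * (1 + log (real q) (real n))"
proof -
  define K where "K = {k. q ^ k < n}"
  have log: "real k \<le> log (real q) (real n)" if "k \<in> K" for k
  proof -
    have "real q ^ k \<le> real n"
      using that by (simp add: K_def flip: of_nat_power)
    then show ?thesis
      using q_ge_2 assms by (simp add: le_log_iff powr_realpow)
  qed
  then have "K \<subseteq> {..nat \<lfloor>log (real q) (real n)\<rfloor>}"
    by (auto simp: le_nat_floor)
  \<comment> \<open>The exponent \<open>0\<close> is counted too, hence the successor.\<close>
  then have finite: "finite K" and "card K \<le> Suc (nat \<lfloor>log (real q) (real n)\<rfloor>)"
    using finite_subset card_mono[of "{..nat \<lfloor>log (real q) (real n)\<rfloor>}" K] by auto
  moreover have "log (real q) (real n) \<ge> 0"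
    using q_ge_2 assms by simp
  ultimately have card_K: "real (card K) \<le> 1 + log (real q) (real n)"
    by linarith
  have "zero_boundary_line_lengths x n \<subseteq> (\<lambda>(k, l). ((\<lambda>l. q * l + \<alpha>) ^^ k) l) ` (K \<times> {1..<\<rho>})"
    using zero_boundary_line_length_eq_iterate by (force simp: K_def)
  then have "card (zero_boundary_line_lengths x n) \<le> card (K \<times> {1..<\<rho>})"
    using finite by (intro surj_card_le) auto
  then have "real (card (zero_boundary_line_lengths x n)) \<le> real (card K * (\<rho> - 1))"
    by (simp only: card_cartesian_product card_atLeastLessThan of_nat_le_iff)
  also have "\<dots> = (real \<rho> - 1) * real (card K)"
    using common_prefix_less_const by (simp add: of_nat_diff)
  also have "\<dots> \<le> (real \<rho> - 1) * (1 + log (real q) (real n))"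
    using card_K common_prefix_less_const by (intro mult_left_mono) auto
  finally show ?thesis .
qed

end

theorem proposition4p2:
  fixes \<zeta> :: substitution and q n :: nat
  assumes "q \<ge> 2"
    and "constant_length \<zeta> q"
    and "primitive \<zeta>"
    and "aperiodic \<zeta>"
    and "hd (\<zeta> 0) = 0"
    and "n \<ge> 2"
  shows "real (card (zero_boundary_line_lengths (fixed_point \<zeta>) n))
           \<le> (real (recognizability_const \<zeta> q) - 1) * (1 + log (real q) (real n))
         \<and> (\<forall>l \<in> zero_boundary_line_lengths (fixed_point \<zeta>) n. l < recognizability_const \<zeta> q * n)"
proof -
  interpret primitive_aperiodic_substitution \<zeta> q
    using assms(1-5) by unfold_locales
  show ?thesis
    using card_zero_boundary_line_lengths zero_boundary_line_length_less assms(6) by simp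
qed

end
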